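(* Let $\mathcal{M}$ be a Riemannian homogeneous space with symmetry group $G = I(\mathcal{M})$. Let $S$ and $U$ be $L^2(\mathcal{M},\mathbf{R})$ or $L^2(G,\mathbf{R})$, and let $F : S \to U$ be a function given by $f \mapsto (f \star w)$. Then $F$ is equivariant with respect to the pullback action of $G$, i.e. $$(\phi \cdot f) \star w = \phi \cdot (f \star w)$$ for $\phi \in G$ a symmetry of $\mathcal{M}$, where $\phi\cdot h := h\circ\phi^{-1}$ for any square-integrable $h : \mathcal{M}\to\mathbf{R}$.
   Context: Standing assumptions: $\mathcal{M}$ is a Riemannian manifold on which its isometry group $G = I(\mathcal{M})$ acts transitively (a Riemannian homogeneous space); $G$ is a locally compact topological group. $\omega^{\mathcal{M}}$ is a suitable volume form on $\mathcal{M}$; no specific volume form is prescribed, and the correlation below is defined using an arbitrary one. $\mu_G$ is the Haar measure on $G$, invariant under translations: $\mu_G(gA)=\mu_G(A)$ for $g\in G$ and measurable $A\subset G$. Functions $\mathcal{M}\to\mathbf{R}$ are assumed square integrable, i.e. $\int_{\mathcal{M}}|f(x)|^2\,\omega^{\mathcal{M}}(x)<\infty$. $L^2(\mathcal{M},\mathbf{R})$ and $L^2(G,\mathbf{R})$ are the spaces of real-valued square-integrable functions on $\mathcal{M}$ and $G$. Action on functions: for $g\in G$ and $h$ a real function on $\mathcal{M}$, $(g\cdot h)(x) = h(g^{-1}\cdot x)$; for $h$ a real function on $G$, $(g\cdot h)(k) = h(g^{-1}k)$. Correlation ($w$ is a real-valued kernel on the same space as $f$): for $f, w : \mathcal{M}\to\mathbf{R}$,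 $f\star w : G \to \mathbf{R}$ is $(f\star w)(g) = \int_{\mathcal{M}} f(x)\,(g\cdot w)(x)\,\omega^{\mathcal{M}}(x)$. For $f, w : G \to \mathbf{R}$, $f\star w : G\to\mathbf{R}$ is $(f\star w)(g) = \int_G f(h)\,(g\cdot w)(h)\,\mu_G(h)$. Equivariance: a map $F: A\to B$ between sets on which $G$ acts is equivariant if $F(g\cdot a) = g\cdot F(a)$ for all $g\in G$, $a \in A$.
   Formalization: The volume form is required to be invariant up to sign under all isometries; for an arbitrary volume form the claim fails, e.g. exp(-x²)dx on the real line with a translation. *)

theory Defs
  imports "HOL-Analysis.Analysis" "HOL-Algebra.Group_Action"
begin

section \<open>Smooth manifolds\<close>

text \<open>\<open>C\<^sup>k\<close> on an open set of a finite-dimensional space.\<close>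

fun Ck_on :: "nat \<Rightarrow> 'a::real_normed_vector set \<Rightarrow> ('a \<Rightarrow> 'b::real_normed_vector) \<Rightarrow> bool" where
  "Ck_on 0 S f \<longleftrightarrow> continuous_on S f"
| "Ck_on (Suc k) S f \<longleftrightarrow> (\<forall>x\<in>S. f differentiable (at x)) \<and>
     (\<forall>v. Ck_on k S (\<lambda>x. frechet_derivative f (at x) v))"

definition smooth_on :: "'a::real_normed_vector set \<Rightarrow> ('a \<Rightarrow> 'b::real_normed_vector) \<Rightarrow> bool" where
  "smooth_on S f \<longleftrightarrow> (\<forall>k. Ck_on k S f)"

text \<open>A chart is a pair of its domain and its coordinate map. A manifold is a Hausdorff,
  second-countable type with an atlas, which need not be maximal.\<close>

type_synonym ('m, 'n) chart = "'m set \<times> ('m \<Rightarrow> real ^ 'n)"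

definition is_chart :: "('m::topological_space, 'n::finite) chart \<Rightarrow> bool" where
  "is_chart c \<longleftrightarrow> open (fst c) \<and> open (snd c ` fst c) \<and>
     homeomorphism (fst c) (snd c ` fst c) (snd c) (inv_into (fst c) (snd c))"

definition local_rep :: "('m \<Rightarrow> 'm) \<Rightarrow> ('m, 'n) chart \<Rightarrow> ('m, 'n) chart \<Rightarrow> real ^ 'n \<Rightarrow> real ^ 'n" where
  "local_rep \<phi> c c' = snd c' \<circ> \<phi> \<circ> inv_into (fst c) (snd c)"

definition jacobian ::
    "('m \<Rightarrow> 'm) \<Rightarrow> ('m, 'n::finite) chart \<Rightarrow> ('m, 'n) chart \<Rightarrow> 'm \<Rightarrow> real ^ 'n ^ 'n" where
  "jacobian \<phi> c c' x = matrix (frechet_derivative (local_rep \<phi> c c') (at (snd c x)))"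

definition smooth_map :: "('m::topological_space, 'n::finite) chart set \<Rightarrow> ('m \<Rightarrow> 'm) \<Rightarrow> bool" where
  "smooth_map A \<phi> \<longleftrightarrow> continuous_on UNIV \<phi> \<and>
     (\<forall>c\<in>A. \<forall>c'\<in>A. smooth_on (snd c ` (fst c \<inter> \<phi> -` fst c')) (local_rep \<phi> c c'))"

text \<open>Since \<^term>\<open>local_rep id c c'\<close> is the transition map from \<open>c\<close> to \<open>c'\<close>, conditions on
  smooth maps also express compatibility between charts, by taking the map to be \<^term>\<open>id\<close>.\<close>

definition smooth_manifold :: "('m::{t2_space,second_countable_topology}, 'n::finite) chart set \<Rightarrow> bool" where
  "smooth_manifold A \<longleftrightarrow> (\<forall>c\<in>A. is_chart c) \<and> (\<Union>c\<in>A. fst c) = UNIV \<and> smooth_map A id"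


section \<open>Riemannian metrics, isometries and volume forms\<close>

text \<open>A metric tensor is given by its matrices \<open>(g\<^sub>i\<^sub>j)\<close> in the charts, as functions of the
  coordinates. The condition below says \<open>\<phi>\<^sup>* g = g\<close>; for \<open>\<phi> = id\<close> it is the transformation law.\<close>

type_synonym ('m, 'n) metric_tensor = "('m, 'n) chart \<Rightarrow> real ^ 'n \<Rightarrow> real ^ 'n ^ 'n"

definition preserves_metric ::
    "('m, 'n::finite) chart set \<Rightarrow> ('m, 'n) metric_tensor \<Rightarrow> ('m \<Rightarrow> 'm) \<Rightarrow> bool" where
  "preserves_metric A g \<phi> \<longleftrightarrow> (\<forall>c\<in>A. \<forall>c'\<in>A. \<forall>x \<in> fst c \<inter> \<phi> -` fst c'.
     g c (snd c x) =
       transpose (jacobian \<phi> c c' x) ** g c' (snd c' (\<phi> x)) ** jacobian \<phi> c c' x)"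

definition riemannian_metric ::
    "('m, 'n::finite) chart set \<Rightarrow> ('m, 'n) metric_tensor \<Rightarrow> bool" where
  "riemannian_metric A g \<longleftrightarrow>
     (\<forall>c\<in>A. smooth_on (snd c ` fst c) (g c) \<and>
        (\<forall>p \<in> snd c ` fst c. transpose (g c p) = g c p \<and> (\<forall>v. v \<noteq> 0 \<longrightarrow> 0 < v \<bullet> (g c p *v v)))) \<and>
     preserves_metric A g id"

definition isometries ::
    "('m::topological_space, 'n::finite) chart set \<Rightarrow> ('m, 'n) metric_tensor \<Rightarrow> ('m \<Rightarrow> 'm) set" where
  "isometries A g = {\<phi>. bij \<phi> \<and> smooth_map A \<phi> \<and> smooth_map A (inv_into UNIV \<phi>) \<and>
     preserves_metric A g \<phi>}"

definition isometry_group ::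
    "('m::topological_space, 'n::finite) chart set \<Rightarrow> ('m, 'n) metric_tensor \<Rightarrow> ('m \<Rightarrow> 'm) monoid" where
  "isometry_group A g = \<lparr>carrier = isometries A g, mult = (\<circ>), one = id\<rparr>"

definition riemannian_homogeneous_space ::
    "('m::{t2_space,second_countable_topology}, 'n::finite) chart set \<Rightarrow> ('m, 'n) metric_tensor \<Rightarrow> bool" where
  "riemannian_homogeneous_space A g \<longleftrightarrow> smooth_manifold A \<and> riemannian_metric A g \<and>
     (\<forall>x y. \<exists>\<phi> \<in> carrier (isometry_group A g). \<phi> x = y)"

text \<open>A volume form is given by its coefficients \<open>\<omega>\<^sub>c\<close> in the charts, that is
  \<open>\<omega> = \<omega>\<^sub>c dx\<^sup>1 \<and> \<dots> \<and> dx\<^sup>n\<close>. Functions are integrated against \<open>\<bar>\<omega>\<bar>\<close>, which for a volume form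
  is the integral with respect to the orientation it defines. Signs are therefore ignored in
  the transformation law and in invariance: this includes the densities on non-orientable
  manifolds, and isometries which reverse the orientation. Equivariance of the correlation on the
  manifold fails for volume forms which the isometries do not preserve in this sense, such as
  \<open>exp (- x\<^sup>2) dx\<close> on \<open>\<real>\<close>.\<close>

type_synonym ('m, 'n) form_coeff = "('m, 'n) chart \<Rightarrow> real ^ 'n \<Rightarrow> real"

definition preserves_volume ::
    "('m, 'n::finite) chart set \<Rightarrow> ('m, 'n) form_coeff \<Rightarrow> ('m \<Rightarrow> 'm) \<Rightarrow> bool" where
  "preserves_volume A \<omega> \<phi> \<longleftrightarrow> (\<forall>c\<in>A. \<forall>c'\<in>A. \<forall>x \<in> fst c \<inter> \<phi> -` fst c'.
     \<bar>\<omega> c (snd c x)\<bar> = \<bar>\<omega> c' (snd c' (\<phi> x))\<bar> * \<bar>det (jacobian \<phi> c c' x)\<bar>)"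

definition volume_form :: "('m, 'n::finite) chart set \<Rightarrow> ('m, 'n) form_coeff \<Rightarrow> bool" where
  "volume_form A \<omega> \<longleftrightarrow>
     (\<forall>c\<in>A. smooth_on (snd c ` fst c) (\<omega> c) \<and> (\<forall>p \<in> snd c ` fst c. \<omega> c p \<noteq> 0)) \<and>
     preserves_volume A \<omega> id"

text \<open>The Borel measure \<open>\<bar>\<omega>\<bar>\<close> on the manifold is determined by its values on the Borel subsets
  of chart domains.\<close>

definition volume_measure ::
    "('m::topological_space, 'n::finite) chart set \<Rightarrow> ('m, 'n) form_coeff \<Rightarrow> 'm measure \<Rightarrow> bool" where
  "volume_measure A \<omega> \<nu> \<longleftrightarrow> sets \<nu> = sets borel \<and>
     (\<forall>c\<in>A. \<forall>B \<in> sets borel. B \<subseteq> fst c \<longrightarrow>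
        emeasure \<nu> B = (\<integral>\<^sup>+p. ennreal \<bar>\<omega> c p\<bar> * indicator (snd c ` B) p \<partial>lborel))"

definition riemannian_volume :: "('m, 'n::finite) metric_tensor \<Rightarrow> ('m, 'n) form_coeff" where
  "riemannian_volume g c p = sqrt (det (g c p))"


subsection \<open>The Riemannian volume form is an invariant volume form\<close>

lemma Ck_on_eq:
  assumes "open S" "\<And>x. x \<in> S \<Longrightarrow> f x = h x" "Ck_on k S f"
  shows "Ck_on k S h"
  using assms
proof (induction k arbitrary: f h)
  case 0
  then show ?case by (simp cong: continuous_on_cong)
next
  case (Suc k)
  have der: "(h has_derivative frechet_derivative f (at x)) (at x)" if "x \<in> S" for x
    using Suc.prems that by (intro has_derivative_transform_within_open[OF _ Suc.prems(1) that Suc.prems(2)])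
      (auto simp: frechet_derivative_works)
  have eq: "frechet_derivative h (at x) = frechet_derivative f (at x)" if "x \<in> S" for x
    using frechet_derivative_at[OF der[OF that]] by simp
  have "Ck_on k S (\<lambda>x. frechet_derivative h (at x) v)" for v
    by (rule Suc.IH[OF Suc.prems(1), of "\<lambda>x. frechet_derivative f (at x) v"])
      (use Suc.prems(3) eq in simp_all)
  then show ?case using der by (auto simp: differentiable_def)
qed

lemma Ck_on_SucI:
  assumes "open S" "\<And>x. x \<in> S \<Longrightarrow> (f has_derivative f' x) (at x)"
    and "\<And>v. Ck_on k S (\<lambda>x. f' x v)"
  shows "Ck_on (Suc k) S f"
proof -
  have eq: "f' x = frechet_derivative f (at x)" if "x \<in> S" for x
    using frechet_derivative_at[OF assms(2)[OF that]] .
  have "Ck_on k S (\<lambda>x. frechet_derivative f (at x) v)" for v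
    by (rule Ck_on_eq[OF assms(1) _ assms(3)[of v]]) (simp add: eq)
  then show ?thesis using assms(2) by (auto simp: differentiable_def)
qed

lemma Ck_on_SucD:
  "Ck_on (Suc k) S f \<Longrightarrow> x \<in> S \<Longrightarrow> (f has_derivative frechet_derivative f (at x)) (at x)"
  by (simp add: frechet_derivative_works)

lemma Ck_on_lower: "Ck_on (Suc k) S f \<Longrightarrow> Ck_on k S f"
proof (induction k arbitrary: f)
  case 0
  then show ?case
    by (auto intro!: continuous_at_imp_continuous_on differentiable_imp_continuous_within)
qed simp

lemma Ck_on_const: "open S \<Longrightarrow> Ck_on k S (\<lambda>x. a)"
proof (induction k arbitrary: a)
  case (Suc k)
  then show ?case by (intro Ck_on_SucI[where f' = "\<lambda>x v. 0"]) auto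
qed simp

lemma Ck_on_add:
  "open S \<Longrightarrow> Ck_on k S f \<Longrightarrow> Ck_on k S h \<Longrightarrow> Ck_on k S (\<lambda>x. f x + h x)"
proof (induction k arbitrary: f h)
  case 0
  then show ?case by (auto intro: continuous_intros)
next
  case (Suc k)
  show ?case
    by (rule Ck_on_SucI[OF Suc.prems(1) has_derivative_add[OF Ck_on_SucD[OF Suc.prems(2)] Ck_on_SucD[OF Suc.prems(3)]]], assumption, assumption)
      (use Suc.prems in \<open>auto intro!: Suc.IH\<close>)
qed

lemma Ck_on_mult:
  fixes f h :: "'a::real_normed_vector \<Rightarrow> real"
  shows "open S \<Longrightarrow> Ck_on k S f \<Longrightarrow> Ck_on k S h \<Longrightarrow> Ck_on k S (\<lambda>x. f x * h x)"
proof (induction k arbitrary: f h)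
  case 0
  then show ?case by (auto intro: continuous_intros)
next
  case (Suc k)
  show ?case
    by (rule Ck_on_SucI[OF Suc.prems(1) has_derivative_mult[OF Ck_on_SucD[OF Suc.prems(2)] Ck_on_SucD[OF Suc.prems(3)]]], assumption, assumption)
      (intro Ck_on_add Suc.IH; use Suc.prems in \<open>simp add: Ck_on_lower\<close>)
qed

lemma Ck_on_linear:
  "bounded_linear L \<Longrightarrow> open S \<Longrightarrow> Ck_on k S f \<Longrightarrow> Ck_on k S (\<lambda>x. L (f x))"
proof (induction k arbitrary: f)
  case 0
  then show ?case by (simp add: bounded_linear.continuous_on)
next
  case (Suc k)
  show ?case
    by (rule Ck_on_SucI[OF Suc.prems(2) bounded_linear.has_derivative[OF Suc.prems(1) Ck_on_SucD[OF Suc.prems(3)]]], assumption)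
      (use Suc.prems in \<open>simp add: Suc.IH\<close>)
qed

lemma Ck_on_powr:
  fixes f :: "'a::real_normed_vector \<Rightarrow> real"
  shows "open S \<Longrightarrow> (\<And>x. x \<in> S \<Longrightarrow> 0 < f x) \<Longrightarrow> Ck_on k S f \<Longrightarrow> Ck_on k S (\<lambda>x. f x powr a)"
proof (induction k arbitrary: a)
  case 0
  then have "continuous_on S (\<lambda>x. f x powr a)"
    by (intro continuous_on_powr continuous_on_const) (auto simp: less_imp_neq[symmetric])
  then show ?case by simp
next
  case (Suc k)
  have der: "((\<lambda>x. f x powr a) has_derivative
      (\<lambda>v. a * (f x powr (a - 1) * frechet_derivative f (at x) v))) (at x)" if "x \<in> S" for x
  proof -
    have "f x powr (a - 1) = f x powr a / f x"
      using Suc.prems(2)[OF that] by (simp add: powr_diff)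
    then show ?thesis
      using has_derivative_powr[OF Ck_on_SucD[OF Suc.prems(3) that] has_derivative_const[of a]
          Suc.prems(2)[OF that] UNIV_I]
      by (simp add: mult_ac)
  qed
  have "Ck_on k S (\<lambda>x. f x powr (a - 1))"
    by (rule Suc.IH[OF Suc.prems(1,2) Ck_on_lower[OF Suc.prems(3)]])
  moreover have "Ck_on k S (\<lambda>x. frechet_derivative f (at x) v)" for v
    using Suc.prems(3) by simp
  ultimately have "Ck_on k S (\<lambda>x. a * (f x powr (a - 1) * frechet_derivative f (at x) v))" for v
    by (simp add: Ck_on_mult Ck_on_const Suc.prems(1))
  note * = this
  show ?case
  proof (rule Ck_on_SucI[OF Suc.prems(1)])
    show "x \<in> S \<Longrightarrow> ((\<lambda>x. f x powr a) has_derivative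
        (\<lambda>v. a * (f x powr (a - 1) * frechet_derivative f (at x) v))) (at x)" for x
      by (fact der)
  qed (fact *)
qed

lemma Ck_on_sum:
  "open S \<Longrightarrow> (\<And>i. i \<in> I \<Longrightarrow> Ck_on k S (f i)) \<Longrightarrow> Ck_on k S (\<lambda>x. \<Sum>i\<in>I. f i x)"
  by (induction I rule: infinite_finite_induct) (simp_all add: Ck_on_const Ck_on_add)

lemma Ck_on_prod:
  fixes f :: "'i \<Rightarrow> 'a::real_normed_vector \<Rightarrow> real"
  shows "open S \<Longrightarrow> (\<And>i. i \<in> I \<Longrightarrow> Ck_on k S (f i)) \<Longrightarrow> Ck_on k S (\<lambda>x. \<Prod>i\<in>I. f i x)"
  by (induction I rule: infinite_finite_induct) (simp_all add: Ck_on_const Ck_on_mult)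

lemma Ck_on_det:
  fixes M :: "'a::real_normed_vector \<Rightarrow> real ^ 'n ^ 'n"
  assumes "open S" "Ck_on k S M"
  shows "Ck_on k S (\<lambda>x. det (M x))"
proof -
  have "bounded_linear (\<lambda>X. X $ i $ j)" for i j :: 'n
    by (intro bounded_linear_compose[OF bounded_linear_vec_nth] bounded_linear_vec_nth)
  then have "Ck_on k S (\<lambda>x. M x $ i $ j)" for i j
    using Ck_on_linear assms by blast
  then show ?thesis
    unfolding det_def using assms(1)
    by (intro Ck_on_sum Ck_on_mult Ck_on_const Ck_on_prod)
qed

lemma pos_def_det_pos:
  fixes M :: "real ^ 'n ^ 'n"
  assumes M: "\<And>v. v \<noteq> 0 \<Longrightarrow> 0 < v \<bullet> (M *v v)"
  shows "0 < det M"
proof (rule ccontr)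
  assume "\<not> 0 < det M"
  define P :: "real \<Rightarrow> real ^ 'n ^ 'n" where "P t = t *\<^sub>R M + (1 - t) *\<^sub>R mat 1" for t
  have "continuous_on {0..1} (\<lambda>t. det (P t))"
    unfolding P_def det_def by (intro continuous_intros)
  moreover have "det (P 1) \<le> 0" "0 \<le> det (P 0)"
    using \<open>\<not> 0 < det M\<close> by (auto simp: P_def)
  ultimately obtain t where t: "0 \<le> t" "t \<le> 1" "det (P t) = 0"
    using IVT2'[of "\<lambda>t. det (P t)" 1 0 0] by auto
  then obtain v where v: "v \<noteq> 0" "P t *v v = 0"
    by (metis invertible_det_nz invertible_left_inverse matrix_left_invertible_ker)
  have "v \<bullet> (P t *v v) = t * (v \<bullet> (M *v v)) + (1 - t) * (v \<bullet> v)"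
    by (simp add: P_def matrix_vector_mult_add_rdistrib scaleR_matrix_vector_assoc[symmetric]
        inner_add_right)
  moreover have "\<dots> > 0"
  proof (cases "t = 0")
    case False
    then have "t * (v \<bullet> (M *v v)) > 0" using M[OF v(1)] t by simp
    then show ?thesis using t(2) by (simp add: add_pos_nonneg)
  qed (use v in simp)
  ultimately show False using v by simp
qed

lemma preserves_riemannian_volume:
  assumes "preserves_metric A g \<phi>"
  shows "preserves_volume A (riemannian_volume g) \<phi>"
  unfolding preserves_volume_def
proof (intro ballI)
  fix c c' x assume "c \<in> A" "c' \<in> A" "x \<in> fst c \<inter> \<phi> -` fst c'"
  then have "det (g c (snd c x)) = det (g c' (snd c' (\<phi> x))) * (det (jacobian \<phi> c c' x))\<^sup>2"
    using assms unfolding preserves_metric_def by (auto simp: det_mul power2_eq_square)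
  then show "\<bar>riemannian_volume g c (snd c x)\<bar> =
      \<bar>riemannian_volume g c' (snd c' (\<phi> x))\<bar> * \<bar>det (jacobian \<phi> c c' x)\<bar>"
    by (simp add: riemannian_volume_def real_sqrt_mult abs_mult)
qed

lemma volume_form_riemannian_volume:
  assumes "smooth_manifold A" "riemannian_metric A g"
  shows "volume_form A (riemannian_volume g)"
    and "\<phi> \<in> isometries A g \<Longrightarrow> preserves_volume A (riemannian_volume g) \<phi>"
proof -
  have pos: "0 < det (g c p)" if "c \<in> A" "p \<in> snd c ` fst c" for c p
    using assms(2) that by (intro pos_def_det_pos) (auto simp: riemannian_metric_def)
  have "smooth_on (snd c ` fst c) (riemannian_volume g c)" if "c \<in> A" for c
    unfolding smooth_on_def
  proof
    fix k
    have S: "open (snd c ` fst c)"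
      using assms(1) that by (auto simp: smooth_manifold_def is_chart_def)
    have gk: "Ck_on k (snd c ` fst c) (g c)"
      using assms(2) that by (simp add: riemannian_metric_def smooth_on_def)
    have "Ck_on k (snd c ` fst c) (\<lambda>p. det (g c p) powr (1/2))"
      by (rule Ck_on_powr[OF S _ Ck_on_det[OF S gk]]) (rule pos[OF that])
    from Ck_on_eq[OF S _ this] show "Ck_on k (snd c ` fst c) (riemannian_volume g c)"
      by (simp add: riemannian_volume_def powr_half_sqrt less_imp_le pos[OF that])
  qed
  moreover have "riemannian_volume g c p \<noteq> 0" if "c \<in> A" "p \<in> snd c ` fst c" for c p
    using pos[OF that] by (simp add: riemannian_volume_def)
  ultimately show "volume_form A (riemannian_volume g)"
    using assms(2) preserves_riemannian_volume[of A g id]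
    by (simp add: volume_form_def riemannian_metric_def)
  show "\<phi> \<in> isometries A g \<Longrightarrow> preserves_volume A (riemannian_volume g) \<phi>"
    by (simp add: isometries_def preserves_riemannian_volume)
qed


section \<open>The topology and the Haar measure of the isometry group\<close>

definition compact_open_topology ::
    "('a::topological_space \<Rightarrow> 'b::topological_space) set \<Rightarrow> ('a \<Rightarrow> 'b) topology" where
  "compact_open_topology C =
     topology_generated_by {{\<phi> \<in> C. \<phi> ` K \<subseteq> U} | K U. compact K \<and> open U}"

definition locally_compact_group :: "('g, 'b) monoid_scheme \<Rightarrow> 'g topology \<Rightarrow> bool" where
  "locally_compact_group G T \<longleftrightarrow> group G \<and> topspace T = carrier G \<and>
     continuous_map (prod_topology T T) T (\<lambda>(h, k). h \<otimes>\<^bsub>G\<^esub> k) \<and>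
     continuous_map T T (\<lambda>h. inv\<^bsub>G\<^esub> h) \<and>
     Hausdorff_space T \<and> locally_compact_space T"

text \<open>A left Haar measure: a non-zero left-invariant Radon measure on the Borel sets.\<close>

definition haar_measure :: "('g, 'b) monoid_scheme \<Rightarrow> 'g topology \<Rightarrow> 'g measure \<Rightarrow> bool" where
  "haar_measure G T \<mu> \<longleftrightarrow>
     space \<mu> = topspace T \<and> sets \<mu> = sigma_sets (topspace T) {U. openin T U} \<and>
     (\<forall>h \<in> carrier G. \<forall>B \<in> sets \<mu>. emeasure \<mu> ((\<lambda>k. h \<otimes>\<^bsub>G\<^esub> k) ` B) = emeasure \<mu> B) \<and>
     emeasure \<mu> (space \<mu>) \<noteq> 0 \<and>
     (\<forall>K. compactin T K \<longrightarrow> emeasure \<mu> K < \<infinity>) \<and>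
     (\<forall>B \<in> sets \<mu>. emeasure \<mu> B = (INF U \<in> {U. openin T U \<and> B \<subseteq> U}. emeasure \<mu> U)) \<and>
     (\<forall>U. openin T U \<longrightarrow> emeasure \<mu> U = (SUP K \<in> {K. compactin T K \<and> K \<subseteq> U}. emeasure \<mu> K))"


section \<open>Square-integrable functions, pullback action and correlation\<close>

text \<open>A function on the space of a measure is represented extensionally, so that functions which
  agree on that space are equal. Functions are not identified up to null sets.\<close>

definition L2 :: "'x measure \<Rightarrow> ('x \<Rightarrow> real) set" where
  "L2 \<mu> = {f \<in> borel_measurable \<mu> \<inter> extensional (space \<mu>). integrable \<mu> (\<lambda>x. (f x)\<^sup>2)}"

text \<open>In the following, \<open>act k x\<close> is the point action of \<open>k \<in> G\<close> on the space of the measure: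
  \<open>k x\<close> on the manifold, and left multiplication on \<open>G\<close>.\<close>

definition pullback ::
    "('g, 'b) monoid_scheme \<Rightarrow> ('g \<Rightarrow> 'x \<Rightarrow> 'x) \<Rightarrow> 'x measure \<Rightarrow> 'g \<Rightarrow> ('x \<Rightarrow> real) \<Rightarrow> 'x \<Rightarrow> real" where
  "pullback G act \<mu> k h = (\<lambda>x \<in> space \<mu>. h (act (inv\<^bsub>G\<^esub> k) x))"

definition pullback_action ::
    "('g, 'b) monoid_scheme \<Rightarrow> ('g \<Rightarrow> 'x \<Rightarrow> 'x) \<Rightarrow> 'x measure \<Rightarrow> 'g \<Rightarrow> ('x \<Rightarrow> real) \<Rightarrow> 'x \<Rightarrow> real" where
  "pullback_action G act \<mu> k = restrict (pullback G act \<mu> k) (L2 \<mu>)"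

definition correlation ::
    "('g, 'b) monoid_scheme \<Rightarrow> ('g \<Rightarrow> 'x \<Rightarrow> 'x) \<Rightarrow> 'x measure \<Rightarrow>
     ('x \<Rightarrow> real) \<Rightarrow> ('x \<Rightarrow> real) \<Rightarrow> 'g \<Rightarrow> real" where
  "correlation G act \<mu> f w = (\<lambda>k \<in> carrier G. \<integral>x. f x * pullback G act \<mu> k w x \<partial>\<mu>)"

definition equivariant ::
    "('g, 'b) monoid_scheme \<Rightarrow> 's set \<Rightarrow> ('g \<Rightarrow> 's \<Rightarrow> 's) \<Rightarrow> 'u set \<Rightarrow> ('g \<Rightarrow> 'u \<Rightarrow> 'u) \<Rightarrow>
     ('s \<Rightarrow> 'u) \<Rightarrow> bool" where
  "equivariant G S \<alpha> U \<beta> F \<longleftrightarrow> group_action G S \<alpha> \<and> group_action G U \<beta> \<and> F \<in> S \<rightarrow> U \<and>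
     (\<forall>k \<in> carrier G. \<forall>s \<in> S. F (\<alpha> k s) = \<beta> k (F s))"

end

theory Submission
  imports Defs
begin

text \<open>For any measure-preserving action of \<open>G\<close>, substituting \<open>x = \<phi> y\<close> in the integral defining
  \<open>((\<phi> \<cdot> f) \<star> w)(k)\<close> turns it into \<open>\<integral> f(y) w(k\<^sup>-\<^sup>1 \<phi> y) dy = (f \<star> w)(\<phi>\<^sup>-\<^sup>1 k)\<close>.
  That isometries preserve the measure of \<open>\<bar>\<omega>\<bar>\<close> on the manifold is the change of variables formula
  for their coordinate representations, on Borel sets which lie in one chart domain and whose
  preimage does too; by second countability every Borel set is a countable disjoint union of
  such sets.\<close>

section \<open>Change of variables on finite-dimensional space\<close>

text \<open>The change of variables theorem of the library needs the coordinates to be indexed by a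
  well-ordered type. The type below is a well-ordered copy of an arbitrary finite type.\<close>

typedef 'a ranked = "UNIV :: 'a set" ..

text \<open>Finite types are countable, so \<open>to_nat\<close> is injective and induces a linear
  order; its well-foundedness is inherited from the natural numbers.\<close>

instantiation ranked :: (finite) wellorder
begin

definition "x \<le> y \<longleftrightarrow> to_nat (Rep_ranked x) \<le> to_nat (Rep_ranked y)"
definition "x < y \<longleftrightarrow> to_nat (Rep_ranked x) < to_nat (Rep_ranked y)"

instance
proof
  fix P :: "'a ranked \<Rightarrow> bool" and a
  assume step: "\<And>x. (\<And>y. y < x \<Longrightarrow> P y) \<Longrightarrow> P x"
  show "P a"
  proof (induction "to_nat (Rep_ranked a)" arbitrary: a rule: less_induct)
    case less
    show ?case by (rule step, rule less) (simp add: less_ranked_def)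
  qed
qed (auto simp: less_eq_ranked_def less_ranked_def Rep_ranked_inject)

end

lemma bij_Rep_ranked: "bij Rep_ranked"
  by (metis UNIV_I bij_iff Abs_ranked_inverse Rep_ranked_inverse)

instance ranked :: (finite) finite
proof
  show "finite (UNIV :: 'a ranked set)"
    using bij_betw_finite[OF bij_Rep_ranked[where 'a = 'a]] by simp
qed

section \<open>Lebesgue measure under relabelling of coordinates\<close>

text \<open>Vectors are functions of the index, so relabelling is contravariant: \<open>e\<close>
  from \<open>'b\<close> to \<open>'a\<close> carries vectors indexed by \<open>'a\<close> to
  vectors indexed by \<open>'b\<close>.\<close>

definition reindex :: "('b \<Rightarrow> 'a) \<Rightarrow> 'c ^ 'a \<Rightarrow> 'c ^ 'b" where
  "reindex e x = (\<chi> i. x $ e i)"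

lemma reindex_nth [simp]: "reindex e x $ i = x $ e i"
  by (simp add: reindex_def)

lemma linear_reindex: "linear (reindex e :: real ^ 'a \<Rightarrow> real ^ 'b)"
  by (rule linearI) (simp_all add: vec_eq_iff)

lemma reindex_inv:
  assumes "bij e"
  shows "reindex (inv_into UNIV e) (reindex e x) = x" "reindex e (reindex (inv_into UNIV e) y) = y"
  using assms by (simp_all add: vec_eq_iff bij_is_surj surj_f_inv_f bij_is_inj inv_f_f)

text \<open>The standard basis of \<open>real ^ 'n\<close> consists of the vectors
  \<open>axis i 1\<close>, so the product over \<open>Basis\<close> in the volume of a box becomes a
  product over indices, which a bijection of indices can then permute.\<close>

lemma emeasure_lborel_box_cart:
  fixes l u :: "real ^ 'n"
  assumes "\<And>i. l $ i \<le> u $ i"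
  shows "emeasure lborel (box l u) = (\<Prod>i\<in>UNIV. u $ i - l $ i)"
proof -
  have "(\<Prod>b\<in>Basis. (u - l) \<bullet> b) = (\<Prod>b\<in>range (\<lambda>i. axis i 1). (u - l) \<bullet> b)"
    by (rule prod.cong) (auto simp: Basis_vec_def)
  also have "\<dots> = (\<Prod>i\<in>UNIV. u $ i - l $ i)"
    by (subst prod.reindex) (auto simp: inj_on_def axis_eq_axis inner_axis)
  finally have "(\<Prod>b\<in>Basis. (u - l) \<bullet> b) = (\<Prod>i\<in>UNIV. u $ i - l $ i)" .
  then show ?thesis
    using assms by (subst emeasure_lborel_box) (auto simp: Basis_vec_def inner_axis)
qed

text \<open>Lebesgue measure is determined by its values on boxes, and the preimage of a box under
  relabelling is a box with the same side lengths in another order.\<close>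

lemma lborel_reindex:
  fixes e :: "'b::finite \<Rightarrow> 'a::finite"
  assumes e: "bij e"
  shows "distr lborel borel (reindex e) = (lborel :: (real ^ 'b) measure)"
proof (rule lborel_eqI[symmetric])
  have [measurable]: "(reindex e :: real ^ 'a \<Rightarrow> real ^ 'b) \<in> borel_measurable borel"
    by (intro borel_measurable_continuous_onI linear_continuous_on linear_conv_bounded_linear[THEN iffD1] linear_reindex)
  fix l u :: "real ^ 'b" assume lu: "\<And>b. b \<in> Basis \<Longrightarrow> l \<bullet> b \<le> u \<bullet> b"
  then have le: "l $ i \<le> u $ i" for i
    using lu[of "axis i 1"] by (simp add: inner_axis)
  \<comment> \<open>The inverse of \<open>e\<close> is onto \<open>'b\<close>, so the conditions
    defining a box can be indexed by \<open>'a\<close> instead.\<close>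
  have all: "(\<forall>i. P i) \<longleftrightarrow> (\<forall>j. P (inv_into UNIV e j))" for P
    using e bij_is_surj[OF bij_imp_bij_inv[OF e]] by (metis surjD)
  have "reindex e -` box l u = box (reindex (inv_into UNIV e) l) (reindex (inv_into UNIV e) u)"
    unfolding set_eq_iff vimage_eq mem_box_cart reindex_nth
    by (subst all) (simp add: e bij_is_surj surj_f_inv_f)
  then have "emeasure (distr lborel borel (reindex e)) (box l u) =
      (\<Prod>j\<in>UNIV. u $ inv_into UNIV e j - l $ inv_into UNIV e j)"
    by (simp add: emeasure_distr emeasure_lborel_box_cart le)
  also have "\<dots> = (\<Prod>i\<in>UNIV. u $ i - l $ i)"
    using prod.reindex_bij_betw[of "inv_into UNIV e" UNIV UNIV "\<lambda>i. u $ i - l $ i"] e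
    by (simp add: bij_betw_inv_into)
  also have "\<dots> = emeasure lborel (box l u)"
    by (simp add: emeasure_lborel_box_cart le)
  finally show "emeasure (distr lborel borel (reindex e)) (box l u) = (\<Prod>b\<in>Basis. (u - l) \<bullet> b)"
    using lu by simp
qed simp

section \<open>Signs and determinants under relabelling\<close>

lemma permutes_UNIV_iff: "p permutes UNIV \<longleftrightarrow> bij p"
  by (auto simp: permutes_bij intro: bij_imp_permutes)

text \<open>Induction over products of transpositions: conjugation by \<open>e\<close> turns the
  transposition of \<open>a\<close> and \<open>b\<close> into that of their preimages, which are
  still distinct, so both sides change sign together.\<close>

lemma sign_conjugate:
  fixes e :: "'b::finite \<Rightarrow> 'a::finite"
  assumes e: "bij e" and p: "p permutes UNIV"
  shows "sign (inv_into UNIV e \<circ> p \<circ> e) = sign p"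
  using p finite[of UNIV]
proof (induction rule: permutes_induct)
  case id
  then show ?case using e by (simp add: bij_is_inj)
next
  case (swap a b p)
  have "inv_into UNIV e x = inv_into UNIV e y \<longleftrightarrow> x = y" for x y
    using e by (simp add: bij_is_surj surj_imp_inj_inv inj_eq)
  then have "inv_into UNIV e (Transposition.transpose a b x) = Transposition.transpose (inv_into UNIV e a) (inv_into UNIV e b) (inv_into UNIV e x)" for x
    by (simp add: Transposition.transpose_def)
  then have eq: "inv_into UNIV e \<circ> (Transposition.transpose a b \<circ> p) \<circ> e =
      Transposition.transpose (inv_into UNIV e a) (inv_into UNIV e b) \<circ> (inv_into UNIV e \<circ> p \<circ> e)"
    by (simp add: fun_eq_iff)
  have "inv_into UNIV e \<circ> p \<circ> e permutes UNIV"
    using e swap.hyps by (simp add: permutes_UNIV_iff bij_imp_bij_inv bij_comp)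
  then have "permutation (inv_into UNIV e \<circ> p \<circ> e)" "permutation p"
    using swap.hyps by (auto simp: permutation_permutes)
  moreover have "inv_into UNIV e a \<noteq> inv_into UNIV e b"
    using e swap.hyps by (metis bij_inv_eq_iff)
  ultimately show ?case
    unfolding eq using swap
    by (simp only: sign_compose permutation_swap_id sign_swap_id if_False)
qed

text \<open>Rows and columns are relabelled simultaneously, so conjugation by \<open>e\<close>
  matches the terms of the two Leibniz sums: it preserves signs and only reorders the factors of
  each product.\<close>

lemma det_reindex:
  fixes M :: "'c::comm_ring_1 ^ 'a ^ 'a" and e :: "'b::finite \<Rightarrow> 'a::finite"
  assumes e: "bij e"
  shows "det (\<chi> i j. M $ e i $ e j) = det M"
  unfolding det_def
proof (rule sum.reindex_bij_witness[where i = "\<lambda>p. inv_into UNIV e \<circ> p \<circ> e" and j = "\<lambda>q. e \<circ> q \<circ> inv_into UNIV e"])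
  fix q :: "'b \<Rightarrow> 'b" assume "q \<in> {q. q permutes UNIV}"
  then have q: "bij q" by (simp add: permutes_bij)
  show *: "inv_into UNIV e \<circ> (e \<circ> q \<circ> inv_into UNIV e) \<circ> e = q"
    using e by (auto simp: fun_eq_iff bij_is_inj bij_is_surj surj_f_inv_f inv_f_f)
  show p: "e \<circ> q \<circ> inv_into UNIV e \<in> {p. p permutes UNIV}"
    using e q by (simp add: permutes_UNIV_iff bij_imp_bij_inv bij_comp)
  have "sign (e \<circ> q \<circ> inv_into UNIV e) = sign q"
    using sign_conjugate[OF e, of "e \<circ> q \<circ> inv_into UNIV e"] p * by simp
  moreover have "(\<Prod>i\<in>UNIV. M $ e i $ e (q i)) = (\<Prod>i\<in>UNIV. M $ i $ (e \<circ> q \<circ> inv_into UNIV e) i)"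
    using e prod.reindex_bij_betw[of e UNIV UNIV "\<lambda>i. M $ i $ (e \<circ> q \<circ> inv_into UNIV e) i"]
    by (simp add: bij_is_inj inv_f_f)
  ultimately show "of_int (sign (e \<circ> q \<circ> inv_into UNIV e)) * (\<Prod>i\<in>UNIV. M $ i $ (e \<circ> q \<circ> inv_into UNIV e) i) =
      of_int (sign q) * (\<Prod>i\<in>UNIV. (\<chi> i j. M $ e i $ e j) $ i $ q i)"
    by simp
next
  fix p :: "'a \<Rightarrow> 'a" assume "p \<in> {p. p permutes UNIV}"
  then have "bij p" by (simp add: permutes_bij)
  then show "inv_into UNIV e \<circ> p \<circ> e \<in> {q. q permutes UNIV}"
    using e by (simp add: permutes_UNIV_iff bij_imp_bij_inv bij_comp)
  show "e \<circ> (inv_into UNIV e \<circ> p \<circ> e) \<circ> inv_into UNIV e = p"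
    using e by (auto simp: fun_eq_iff bij_is_inj bij_is_surj surj_f_inv_f inv_f_f)
qed

section \<open>Substitution in integrals of non-negative Borel functions\<close>

lemma set_nn_integral_ennreal:
  "(\<integral>\<^sup>+x\<in>A. ennreal (f x) \<partial>M) = (\<integral>\<^sup>+x. ennreal (indicator A x * f x) \<partial>M)"
  by (intro nn_integral_cong) (auto simp: indicator_def)

text \<open>A bridge between gauge integrals and Lebesgue integrals of non-negative functions. Borel
  measurability allows passing from the completed measure \<open>lebesgue\<close> to
  \<open>lborel\<close>.\<close>

lemma has_integral_iff_set_nn_integral:
  fixes f :: "'a::euclidean_space \<Rightarrow> real"
  assumes f: "set_borel_measurable borel S f" and nonneg: "\<And>x. x \<in> S \<Longrightarrow> 0 \<le> f x"
  shows "(f has_integral r) S \<longleftrightarrow> (\<integral>\<^sup>+x\<in>S. ennreal (f x) \<partial>lborel) = ennreal r \<and> 0 \<le> r"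
proof -
  let ?f = "\<lambda>x. indicator S x * f x"
  have eq: "(\<lambda>x. if x \<in> S then f x else 0) = ?f"
    by (auto simp: indicator_def)
  have "?f \<in> borel_measurable lebesgue"
    using f by (intro measurable_completion) (simp add: set_borel_measurable_def)
  then have "(?f has_integral r) UNIV \<longleftrightarrow> (\<integral>\<^sup>+x. ennreal (?f x) \<partial>lebesgue) = ennreal r \<and> 0 \<le> r"
    using nonneg by (subst has_integral_iff_nn_integral_lebesgue) (auto simp: indicator_def)
  moreover have "(\<integral>\<^sup>+x. ennreal (?f x) \<partial>lebesgue) = (\<integral>\<^sup>+x\<in>S. ennreal (f x) \<partial>lborel)"
    unfolding nn_integral_completion set_nn_integral_ennreal ..
  ultimately show ?thesis
    by (simp add: has_integral_restrict_UNIV[symmetric, of f] eq)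
qed

lemma nn_integral_change_of_variables_wellorder:
  fixes f :: "real ^ 'n::{finite,wellorder} \<Rightarrow> real" and g :: "real ^ 'n::_ \<Rightarrow> real ^ 'n::_"
  assumes S: "S \<in> sets borel"
    and der: "\<And>x. x \<in> S \<Longrightarrow> (g has_derivative g' x) (at x within S)"
    and inj: "inj_on g S"
    and f: "set_borel_measurable borel (g ` S) f" "\<And>y. y \<in> g ` S \<Longrightarrow> 0 \<le> f y"
    and gf: "set_borel_measurable borel S (\<lambda>x. \<bar>det (matrix (g' x))\<bar> * f (g x))"
  shows "(\<integral>\<^sup>+x\<in>S. ennreal (\<bar>det (matrix (g' x))\<bar> * f (g x)) \<partial>lborel) =
    (\<integral>\<^sup>+y\<in>g ` S. ennreal (f y) \<partial>lborel)" (is "?l = ?r")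
proof -
  let ?h = "\<lambda>x. \<bar>det (matrix (g' x))\<bar> * f (g x)"
  have S': "S \<in> sets lebesgue" using S by simp
  \<comment> \<open>the library theorem is about functions with values in \<open>real ^ 'n\<close>, hence the detour through
    \<open>real ^ 1\<close>\<close>
  have nonneg_iff: "(k has_integral r) A \<longleftrightarrow>
      (\<lambda>x. vec (k x) :: real^1) absolutely_integrable_on A \<and> integral A (\<lambda>x. vec (k x) :: real^1) = vec r"
    if "\<And>x. x \<in> A \<Longrightarrow> 0 \<le> k x" for k :: "real ^ 'n::_ \<Rightarrow> real" and A r
  proof -
    have "k absolutely_integrable_on A \<longleftrightarrow> k integrable_on A"
      using that by (rule absolutely_integrable_on_iff_nonneg)
    then show ?thesis
      by (simp add: absolutely_integrable_on_1_iff integral_on_1_eq has_integral_iff vec_eq_iff)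
  qed
  have vec: "c *\<^sub>R (vec y :: real^1) = vec (c * y)" for c y :: real
    by (simp add: vec_eq_iff)
  have "(?h has_integral r) S \<longleftrightarrow> (f has_integral r) (g ` S)" for r
    using has_absolute_integral_change_of_variables[OF S' der inj, of "\<lambda>x. vec (f x) :: real^1" "vec r"]
      nonneg_iff[of S ?h r] nonneg_iff[of "g ` S" f r] f(2)
    unfolding vec by simp
  \<comment> \<open>The two integrals take the same finite values; no finiteness has been assumed so
    far.\<close>
  then have iff: "?l = ennreal r \<longleftrightarrow> ?r = ennreal r" if "0 \<le> r" for r
    using has_integral_iff_set_nn_integral[OF gf, of r] has_integral_iff_set_nn_integral[OF f, of r] f(2) that
    by simp
  show ?thesis
  proof (cases ?l rule: ennreal_cases)
    \<comment> \<open>If the right-hand side were finite, \<open>iff\<close> would force the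
      left-hand side to be finite as well.\<close>
    case top
    then show ?thesis using iff by (cases ?r rule: ennreal_cases) auto
  qed (use iff in auto)
qed

text \<open>Conjugating \<open>g\<close> with the relabelling of coordinates by
  \<open>Rep_ranked\<close> reduces to well-ordered indices, since relabelling preserves both
  Lebesgue measure and the Jacobian determinant.\<close>

theorem nn_integral_change_of_variables:
  fixes f :: "real ^ 'n \<Rightarrow> real" and g :: "real ^ 'n \<Rightarrow> real ^ 'n"
  assumes S: "S \<in> sets borel"
    and der: "\<And>x. x \<in> S \<Longrightarrow> (g has_derivative g' x) (at x within S)"
    and inj: "inj_on g S"
    and f: "set_borel_measurable borel (g ` S) f" "\<And>y. y \<in> g ` S \<Longrightarrow> 0 \<le> f y"
    and gf: "set_borel_measurable borel S (\<lambda>x. \<bar>det (matrix (g' x))\<bar> * f (g x))"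
  shows "(\<integral>\<^sup>+x\<in>S. ennreal (\<bar>det (matrix (g' x))\<bar> * f (g x)) \<partial>lborel) =
    (\<integral>\<^sup>+y\<in>g ` S. ennreal (f y) \<partial>lborel)"
proof -
  let ?r = "reindex Rep_ranked :: real ^ 'n \<Rightarrow> real ^ 'n ranked"
  let ?s = "reindex (inv_into UNIV Rep_ranked) :: real ^ 'n ranked \<Rightarrow> real ^ 'n"
  note [simp] = reindex_inv[OF bij_Rep_ranked]
  have bl: "bounded_linear ?r" "bounded_linear ?s"
    by (simp_all add: linear_conv_bounded_linear[symmetric] linear_reindex)
  have meas [measurable]: "?r \<in> borel_measurable borel" "?s \<in> borel_measurable borel"
    by (intro borel_measurable_continuous_onI linear_continuous_on bl)+
  have transfer: "(\<integral>\<^sup>+x\<in>A. ennreal (k x) \<partial>lborel) = (\<integral>\<^sup>+y\<in>?s -` A. ennreal (k (?s y)) \<partial>lborel)"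
    if "set_borel_measurable borel A k" for k and A :: "(real ^ 'n) set"
  proof -
    have *: "(\<lambda>x. ennreal (indicator A x * k x)) \<in> borel_measurable borel"
      using that by (simp add: set_borel_measurable_def)
    have "(\<integral>\<^sup>+y. ennreal (indicator A (?s y) * k (?s y)) \<partial>lborel) =
        (\<integral>\<^sup>+x. ennreal (indicator A x * k x) \<partial>distr lborel borel ?s)"
      using * by (subst nn_integral_distr) auto
    also have "distr lborel borel ?s = lborel"
      by (rule lborel_reindex) (simp add: bij_imp_bij_inv bij_Rep_ranked)
    finally show ?thesis
      unfolding set_nn_integral_ennreal by (simp add: indicator_def)
  qed
  define G where "G = ?r \<circ> g \<circ> ?s"
  define G' where "G' y = ?r \<circ> g' (?s y) \<circ> ?s" for y
  have vimage: "?s -` B = ?r ` B" for B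
    by (force simp: image_iff intro: reindex_inv(2)[OF bij_Rep_ranked, symmetric])
  have image: "G ` (?s -` S) = ?s -` (g ` S)"
    by (simp add: vimage G_def image_comp[symmetric] image_image)
  have det: "det (matrix (G' y)) = det (matrix (g' (?s y)))" for y
  proof -
    have ax: "?s (axis j 1) = axis (Rep_ranked j) 1" for j
      by (auto simp: vec_eq_iff axis_def bij_Rep_ranked bij_is_inj bij_is_surj surj_f_inv_f inv_f_f)
    \<comment> \<open>The columns of a matrix are the images of the basis vectors, and
      \<open>?s\<close> maps basis vectors to basis vectors.\<close>
    have "matrix (G' y) = (\<chi> i j. matrix (g' (?s y)) $ Rep_ranked i $ Rep_ranked j)"
      by (simp add: matrix_def G'_def ax)
    then show ?thesis using det_reindex[OF bij_Rep_ranked] by simp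
  qed
  have "(\<integral>\<^sup>+x\<in>S. ennreal (\<bar>det (matrix (g' x))\<bar> * f (g x)) \<partial>lborel) =
      (\<integral>\<^sup>+y\<in>?s -` S. ennreal (\<bar>det (matrix (G' y))\<bar> * f (?s (G y))) \<partial>lborel)"
    unfolding transfer[OF gf] by (simp add: det G_def)
  also have "\<dots> = (\<integral>\<^sup>+y\<in>G ` (?s -` S). ennreal (f (?s y)) \<partial>lborel)"
  proof (rule nn_integral_change_of_variables_wellorder)
    show "?s -` S \<in> sets borel"
      using measurable_sets[OF meas(2) S] by simp
    show "inj_on G (?s -` S)"
    proof (rule inj_onI)
      fix y z assume "y \<in> ?s -` S" "z \<in> ?s -` S" "G y = G z"
      then have "?s (G y) = ?s (G z)" by simp
      then have "g (?s y) = g (?s z)" by (simp add: G_def)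
      then have "?s y = ?s z"
        by (rule inj_onD[OF inj]) (use \<open>y \<in> ?s -` S\<close> \<open>z \<in> ?s -` S\<close> in simp_all)
      then have "?r (?s y) = ?r (?s z)" by simp
      then show "y = z" by simp
    qed
    show "(G has_derivative G' y) (at y within ?s -` S)" if "y \<in> ?s -` S" for y
    proof -
      have "(?s has_derivative ?s) (at y within ?s -` S)"
        by (rule bounded_linear_imp_has_derivative[OF bl(2)])
      moreover have "(g has_derivative g' (?s y)) (at (?s y) within ?s ` (?s -` S))"
        using der[of "?s y"] that by (auto intro: has_derivative_subset)
      ultimately have "((\<lambda>y. g (?s y)) has_derivative (\<lambda>v. g' (?s y) (?s v))) (at y within ?s -` S)"
        by (rule has_derivative_in_compose)
      then show ?thesis
        unfolding G_def G'_def o_def by (rule bounded_linear.has_derivative[OF bl(1)])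
    qed
    show "set_borel_measurable borel (G ` (?s -` S)) (\<lambda>y. f (?s y))"
      using measurable_compose[OF meas(2), of "\<lambda>x. indicat_real (g ` S) x *\<^sub>R f x" borel] f(1)
      unfolding image set_borel_measurable_def by (simp add: indicator_def)
    show "set_borel_measurable borel (?s -` S) (\<lambda>y. \<bar>det (matrix (G' y))\<bar> * f (?s (G y)))"
      using measurable_compose[OF meas(2), of "\<lambda>x. indicat_real S x *\<^sub>R (\<bar>det (matrix (g' x))\<bar> * f (g x))" borel] gf
      unfolding set_borel_measurable_def det by (simp add: indicator_def G_def)
    show "0 \<le> f (?s y)" if "y \<in> G ` (?s -` S)" for y
      using that f(2) unfolding image by auto
  qed
  also have "\<dots> = (\<integral>\<^sup>+y\<in>g ` S. ennreal (f y) \<partial>lborel)"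
    unfolding transfer[OF f(1)] image ..
  finally show ?thesis .
qed

section \<open>Correlation for a measure-preserving group action\<close>

text \<open>Covers both the isometries acting on the manifold and left multiplication on
  \<open>G\<close>. The action laws are restricted to \<open>space M\<close> because multiplication
  in \<open>G\<close> is only controlled on the carrier. Invariance is phrased by
  \<open>distr\<close>, the form in which integrals are transformed.\<close>

locale measure_preserving_action = group G for G (structure) +
  fixes act :: "'a \<Rightarrow> 'x \<Rightarrow> 'x" and M :: "'x measure"
  assumes act_measurable [measurable]: "k \<in> carrier G \<Longrightarrow> act k \<in> M \<rightarrow>\<^sub>M M"
    and act_distr: "k \<in> carrier G \<Longrightarrow> distr M M (act k) = M"
    and act_mult: "\<lbrakk>h \<in> carrier G; k \<in> carrier G; x \<in> space M\<rbrakk> \<Longrightarrow> act (h \<otimes> k) x = act h (act k x)"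
    and act_one: "x \<in> space M \<Longrightarrow> act \<one> x = x"
begin

lemma act_space: "k \<in> carrier G \<Longrightarrow> x \<in> space M \<Longrightarrow> act k x \<in> space M"
  using measurable_space[OF act_measurable] .

lemma pullback_eq: "x \<in> space M \<Longrightarrow> pullback G act M k f x = f (act (inv k) x)"
  by (simp add: pullback_def)

lemma pullback_measurable:
  assumes "k \<in> carrier G" "f \<in> borel_measurable M"
  shows "pullback G act M k f \<in> borel_measurable M"
proof -
  have "(\<lambda>x. f (act (inv k) x)) \<in> borel_measurable M"
    using assms by (auto intro: measurable_compose[OF act_measurable])
  then show ?thesis
    by (simp add: pullback_eq cong: measurable_cong)
qed

lemma pullback_L2:
  assumes k: "k \<in> carrier G" and f: "f \<in> L2 M"
  shows "pullback G act M k f \<in> L2 M"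
proof -
  have "integrable (distr M M (act (inv k))) (\<lambda>x. (f x)\<^sup>2)"
    using k f by (simp add: act_distr L2_def)
  then have "integrable M (\<lambda>x. (f (act (inv k) x))\<^sup>2)"
    using k f by (subst (asm) integrable_distr_eq) (auto simp: L2_def)
  then have "integrable M (\<lambda>x. (pullback G act M k f x)\<^sup>2)"
    by (simp add: pullback_eq cong: Bochner_Integration.integrable_cong)
  then show ?thesis
    using pullback_measurable[OF k] f by (simp add: L2_def) (simp add: pullback_def)
qed

lemma pullback_one: "f \<in> L2 M \<Longrightarrow> pullback G act M \<one> f = f"
  by (auto simp: L2_def pullback_def act_one intro: extensionalityI)

text \<open>Inversion reverses the order of a product and so does precomposition; the two reversals
  cancel, which makes pullback a left action.\<close>

lemma pullback_mult:
  assumes "h \<in> carrier G" "k \<in> carrier G"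
  shows "pullback G act M (h \<otimes> k) f = pullback G act M h (pullback G act M k f)"
  using assms by (auto simp: pullback_def fun_eq_iff inv_mult_group act_mult act_space)

text \<open>Pullback by \<open>inv k\<close> inverts pullback by \<open>k\<close>. Restriction to
  \<open>L2 M\<close> makes the maps extensional, as membership in \<open>Bij\<close>
  requires.\<close>

lemma group_action_pullback: "group_action G (L2 M) (pullback_action G act M)"
proof -
  have "pullback_action G act M k \<in> Bij (L2 M)" if k: "k \<in> carrier G" for k
  proof -
    have "bij_betw (pullback G act M k) (L2 M) (L2 M)"
      by (rule bij_betw_byWitness[where f' = "pullback G act M (inv k)"])
        (use k in \<open>auto simp: pullback_L2 pullback_one pullback_mult[symmetric]\<close>)
    then show ?thesis
      unfolding Bij_def pullback_action_def by (simp cong: bij_betw_cong)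
  qed
  note Bij = this
  have "pullback_action G act M \<in> hom G (BijGroup (L2 M))"
  proof (rule homI)
    fix h k assume hk: "h \<in> carrier G" "k \<in> carrier G"
    have "pullback_action G act M (h \<otimes> k) =
        compose (L2 M) (pullback_action G act M h) (pullback_action G act M k)"
      using hk by (auto simp: fun_eq_iff compose_def pullback_action_def pullback_mult pullback_L2)
    then show "pullback_action G act M (h \<otimes> k) =
        pullback_action G act M h \<otimes>\<^bsub>BijGroup (L2 M)\<^esub> pullback_action G act M k"
      using hk by (simp add: BijGroup_def Bij)
  qed (simp add: BijGroup_def Bij)
  then show ?thesis
    by (intro group_action.intro group_hom.intro group_hom_axioms.intro is_group group_BijGroup)
qed

lemma correlation_pullback:
  assumes f: "f \<in> L2 M" and w: "w \<in> L2 M" and phi: "\<phi> \<in> carrier G" and k: "k \<in> carrier G"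
  shows "correlation G act M (pullback G act M \<phi> f) w k = correlation G act M f w (inv \<phi> \<otimes> k)"
proof -
  let ?h = "inv \<phi> \<otimes> k"
  have fm: "f \<in> borel_measurable M" and wm: "w \<in> borel_measurable M"
    using f w by (auto simp: L2_def)
  have h: "inv \<phi> \<otimes> k \<in> carrier G"
    using phi k by simp
  \<comment> \<open>Applying \<open>inv ?h\<close> after \<open>inv \<phi>\<close> is then applying
    \<open>inv k\<close>, so the kernel shifted by \<open>?h\<close> and evaluated at the moved
    point is the kernel shifted by \<open>k\<close>.\<close>
  have k_eq: "inv k = inv ?h \<otimes> inv \<phi>"
    using phi k by (simp add: inv_mult_group m_assoc)
  have "correlation G act M f w ?h = (\<integral>x. f x * pullback G act M ?h w x \<partial>M)"
    using h by (simp add: correlation_def)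
  \<comment> \<open>The computation starts from the value at \<open>?h\<close>: invariance replaces
    the measure by its image under \<open>inv \<phi>\<close>, which places \<open>inv \<phi>\<close>
    inside both factors.\<close>
  also have "\<dots> = (\<integral>x. f x * pullback G act M ?h w x \<partial>distr M M (act (inv \<phi>)))"
    using phi by (simp add: act_distr)
  also have "\<dots> = (\<integral>x. f (act (inv \<phi>) x) * pullback G act M ?h w (act (inv \<phi>) x) \<partial>M)"
    using phi fm pullback_measurable[OF h wm] by (intro integral_distr) auto
  also have "\<dots> = (\<integral>x. pullback G act M \<phi> f x * pullback G act M k w x \<partial>M)"
    using phi h by (intro Bochner_Integration.integral_cong)
      (auto simp: pullback_eq act_space k_eq act_mult simp del: inv_mult_group)
  also have "\<dots> = correlation G act M (pullback G act M \<phi> f) w k"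
    using k by (simp add: correlation_def)
  finally show ?thesis ..
qed

lemma correlation_equivariant:
  assumes N: "measure_preserving_action G (mult G) N" "space N = carrier G"
    and w: "w \<in> L2 M" and F: "F \<in> L2 M \<rightarrow> L2 N" "\<forall>f \<in> L2 M. F f = correlation G act M f w"
  shows "equivariant G (L2 M) (pullback_action G act M) (L2 N) (pullback_action G (mult G) N) F \<and>
    (\<forall>\<phi> \<in> carrier G. \<forall>f \<in> L2 M. correlation G act M (pullback G act M \<phi> f) w =
       pullback G (mult G) N \<phi> (correlation G act M f w))"
proof -
  interpret N: measure_preserving_action G "mult G" N by fact
  have eq: "correlation G act M (pullback G act M \<phi> f) w =
      pullback G (mult G) N \<phi> (correlation G act M f w)"
    if phi: "\<phi> \<in> carrier G" and f: "f \<in> L2 M" for \<phi> f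
  proof
    fix k show "correlation G act M (pullback G act M \<phi> f) w k =
        pullback G (mult G) N \<phi> (correlation G act M f w) k"
    proof (cases "k \<in> carrier G")
      case True
      then show ?thesis
        using correlation_pullback[OF f w phi] by (simp add: N.pullback_eq N(2))
    next
      \<comment> \<open>Outside the carrier both sides are \<open>undefined\<close>, since
        correlations and pullbacks are extensional.\<close>
      case False
      then show ?thesis
        by (simp add: correlation_def pullback_def N(2))
    qed
  qed
  moreover have "F (pullback_action G act M \<phi> f) = pullback_action G (mult G) N \<phi> (F f)"
    if "\<phi> \<in> carrier G" "f \<in> L2 M" for \<phi> f
    using that F eq[OF that] by (simp add: pullback_action_def pullback_L2 Pi_iff)
  ultimately show ?thesis
    using F(1) group_action_pullback N.group_action_pullback by (simp add: equivariant_def)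
qed

end

section \<open>Invariance of the two measures\<close>

text \<open>Left invariance of \<open>\<mu>\<close> concerns images of sets whereas
  \<open>distr\<close> concerns preimages. Invariance is therefore applied to the preimage of
  \<open>B\<close>, whose translate is \<open>B\<close> again.\<close>

lemma haar_measure_preserving_action:
  assumes G: "locally_compact_group G T" and haar: "haar_measure G T \<mu>"
  shows "measure_preserving_action G (mult G) \<mu>"
proof -
  interpret group G
    using G by (simp add: locally_compact_group_def)
  have T: "topspace T = carrier G"
    and cont: "continuous_map (prod_topology T T) T (\<lambda>(h, k). h \<otimes>\<^bsub>G\<^esub> k)"
    using G by (simp_all add: locally_compact_group_def)
  have space: "space \<mu> = carrier G"
    and sets: "sets \<mu> = sigma_sets (carrier G) {U. openin T U}"
    and inv: "\<And>h B. h \<in> carrier G \<Longrightarrow> B \<in> sets \<mu> \<Longrightarrow>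
      emeasure \<mu> ((\<lambda>k. h \<otimes>\<^bsub>G\<^esub> k) ` B) = emeasure \<mu> B"
    using haar unfolding haar_measure_def T by blast+
  have meas: "mult G h \<in> \<mu> \<rightarrow>\<^sub>M \<mu>" if h: "h \<in> carrier G" for h
  proof (rule measurable_sigma_sets[OF sets])
    \<comment> \<open>Left translation is joint multiplication restricted to the slice with first
      coordinate \<open>h\<close>.\<close>
    have "continuous_map T (prod_topology T T) (\<lambda>k. (h, k))"
      using h T by (simp add: continuous_map_pairedI)
    from continuous_map_compose[OF this cont]
    have "continuous_map T T (mult G h)"
      by (simp add: o_def)
    then show "mult G h -` U \<inter> space \<mu> \<in> sets \<mu>" if "U \<in> {U. openin T U}" for U
      using that openin_continuous_map_preimage[of T T "mult G h" U] unfolding sets space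
      by (auto simp: T vimage_def Int_def conj_commute intro!: sigma_sets.Basic)
    show "{U. openin T U} \<subseteq> Pow (carrier G)"
      using openin_subset[of T] T by auto
    show "mult G h \<in> space \<mu> \<rightarrow> carrier G"
      using h by (auto simp: space T)
  qed
  show ?thesis
  proof (unfold_locales)
    fix h assume h: "h \<in> carrier G"
    show "mult G h \<in> \<mu> \<rightarrow>\<^sub>M \<mu>" by (rule meas[OF h])
    show "distr \<mu> \<mu> (mult G h) = \<mu>"
    proof (rule measure_eqI)
      fix B assume "B \<in> sets (distr \<mu> \<mu> (mult G h))"
      then have B: "B \<in> sets \<mu>" by simp
      let ?C = "mult G h -` B \<inter> space \<mu>"
      have "x \<in> mult G h ` ?C" if "x \<in> B" for x
      proof
        have "x \<in> carrier G"
          using that sets.sets_into_space[OF B] space by auto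
        then show "x = h \<otimes>\<^bsub>G\<^esub> (inv\<^bsub>G\<^esub> h \<otimes>\<^bsub>G\<^esub> x)" "inv\<^bsub>G\<^esub> h \<otimes>\<^bsub>G\<^esub> x \<in> ?C"
          using h that by (auto simp: m_assoc[symmetric] space)
      qed
      then have "mult G h ` ?C = B" by auto
      then show "emeasure (distr \<mu> \<mu> (mult G h)) B = emeasure \<mu> B"
        using inv[OF h measurable_sets[OF meas[OF h] B]] B meas[OF h] by (simp add: emeasure_distr)
    qed simp
  qed (auto simp: space m_assoc)
qed

section \<open>Invariance of the volume measure under isometries\<close>

lemma chart_inj_on: "is_chart c \<Longrightarrow> inj_on (snd c) (fst c)"
  unfolding is_chart_def homeomorphism_def by (metis inj_on_inverseI)

text \<open>The image of \<open>B\<close> is its preimage under the inverse coordinate map, which is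
  continuous on an open set.\<close>

lemma chart_image_borel:
  assumes c: "is_chart c" and B: "B \<in> sets borel" "B \<subseteq> fst c"
  shows "snd c ` B \<in> sets borel"
proof -
  let ?V = "snd c ` fst c" and ?i = "inv_into (fst c) (snd c)"
  have V: "open ?V" "continuous_on ?V ?i"
    using c by (auto simp: is_chart_def homeomorphism_def)
  have "?i \<in> restrict_space borel ?V \<rightarrow>\<^sub>M borel"
    by (rule borel_measurable_continuous_on_restrict[OF V(2)])
  from measurable_sets[OF this B(1)] have "?i -` B \<inter> ?V \<in> sets borel"
    using V(1) by (simp add: space_restrict_space sets_restrict_space_iff)
  also have "?i -` B \<inter> ?V = snd c ` B"
    using B(2) chart_inj_on[OF c] by (auto simp: inv_into_f_f subset_iff)
  finally show ?thesis .
qed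

text \<open>In coordinates both measures are integrals of densities. Preservation of the volume form
  says that the density in \<open>c\<close> is the density in \<open>c'\<close> composed with
  \<open>local_rep \<phi> c c'\<close>, times the absolute Jacobian determinant, which is the
  integrand of the substitution rule.\<close>

lemma volume_measure_vimage_chart:
  fixes A :: "('m::{t2_space,second_countable_topology}, 'n::finite) chart set"
  assumes A: "smooth_manifold A" and om: "volume_form A \<omega>" and nu: "volume_measure A \<omega> \<nu>"
    and phi: "bij \<phi>" "smooth_map A \<phi>" "preserves_volume A \<omega> \<phi>"
    and c: "c \<in> A" "c' \<in> A"
    and D: "D \<in> sets borel" "D \<subseteq> fst c'" "\<phi> -` D \<subseteq> fst c"
  shows "emeasure \<nu> (\<phi> -` D) = emeasure \<nu> D"
proof -
  let ?\<psi> = "local_rep \<phi> c c'" and ?B = "\<phi> -` D"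
  let ?S = "snd c ` ?B" and ?W = "snd c ` (fst c \<inter> \<phi> -` fst c')"
  let ?d = "\<lambda>p. frechet_derivative ?\<psi> (at p)"
  have charts: "is_chart c" "is_chart c'"
    using A c by (auto simp: smooth_manifold_def)
  have "continuous_on UNIV \<phi>"
    using phi(2) by (simp add: smooth_map_def)
  then have B: "?B \<in> sets borel"
    using D(1) measurable_sets[OF borel_measurable_continuous_onI] by fastforce
  have inv: "inv_into (fst c) (snd c) (snd c x) = x" if "x \<in> ?B" for x
    using chart_inj_on[OF charts(1)] that D(3) by (auto intro: inv_into_f_f)
  have psi: "?\<psi> (snd c x) = snd c' (\<phi> x)" if "x \<in> ?B" for x
    using inv[OF that] by (simp add: local_rep_def)
  have image: "?\<psi> ` ?S = snd c' ` D"
  proof -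
    have "?\<psi> ` ?S = snd c' ` \<phi> ` ?B"
      using psi by (force simp: image_iff)
    also have "\<phi> ` ?B = D"
      using phi(1) by (simp add: bij_is_surj surj_image_vimage_eq)
    finally show ?thesis .
  qed
  have S: "?S \<in> sets borel" and S': "snd c' ` D \<in> sets borel"
    by (rule chart_image_borel[OF charts(1) B D(3)], rule chart_image_borel[OF charts(2) D(1,2)])
  have jac: "\<bar>\<omega> c p\<bar> = \<bar>det (matrix (?d p))\<bar> * \<bar>\<omega> c' (?\<psi> p)\<bar>" if p: "p \<in> ?S" for p
  proof -
    obtain x where x: "p = snd c x" "x \<in> ?B" using p by blast
    then have "x \<in> fst c \<inter> \<phi> -` fst c'" using D by auto
    then show ?thesis
      using phi(3) c x psi[OF x(2)] by (auto simp: preserves_volume_def jacobian_def mult.commute)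
  qed
  have cont: "continuous_on (snd e ` E) (\<lambda>p. \<bar>\<omega> e p\<bar>)" if "e \<in> A" "E \<subseteq> fst e" for e E
  proof -
    have "Ck_on 0 (snd e ` fst e) (\<omega> e)"
      using om that(1) unfolding volume_form_def smooth_on_def by blast
    then have "continuous_on (snd e ` E) (\<omega> e)"
      using that(2) by (auto intro: continuous_on_subset)
    then show ?thesis by (rule continuous_on_rabs)
  qed
  have meas: "set_borel_measurable borel (snd e ` E) (\<lambda>p. \<bar>\<omega> e p\<bar>)"
    if "e \<in> A" "E \<subseteq> fst e" "snd e ` E \<in> sets borel" for e E
    unfolding set_borel_measurable_def
    by (rule borel_measurable_continuous_on_indicator[OF that(3) cont[OF that(1,2)]])
  have "emeasure \<nu> ?B = (\<integral>\<^sup>+p\<in>?S. ennreal \<bar>\<omega> c p\<bar> \<partial>lborel)"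
    using nu c(1) B D(3) by (simp add: volume_measure_def)
  also have "\<dots> = (\<integral>\<^sup>+p\<in>?S. ennreal (\<bar>det (matrix (?d p))\<bar> * \<bar>\<omega> c' (?\<psi> p)\<bar>) \<partial>lborel)"
    by (intro nn_integral_cong) (simp add: jac indicator_def)
  also have "\<dots> = (\<integral>\<^sup>+q\<in>?\<psi> ` ?S. ennreal \<bar>\<omega> c' q\<bar> \<partial>lborel)"
  proof (rule nn_integral_change_of_variables[OF S])
    fix p assume "p \<in> ?S"
    then have p: "p \<in> ?W" using D by auto
    have "Ck_on (Suc 0) ?W ?\<psi>"
      using phi(2) c unfolding smooth_map_def smooth_on_def by blast
    then show "(?\<psi> has_derivative ?d p) (at p within ?S)"
      using Ck_on_SucD[OF _ p] by (blast intro: has_derivative_at_withinI)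
  next
    show "inj_on ?\<psi> ?S"
    proof (rule inj_onI)
      fix p q assume pq: "p \<in> ?S" "q \<in> ?S" "?\<psi> p = ?\<psi> q"
      then obtain x y where xy: "p = snd c x" "q = snd c y" "x \<in> ?B" "y \<in> ?B" by auto
      then have "snd c' (\<phi> x) = snd c' (\<phi> y)" using pq psi by simp
      then have "\<phi> x = \<phi> y"
        using xy D(2) by (intro inj_onD[OF chart_inj_on[OF charts(2)]]) auto
      then show "p = q" using xy phi(1) by (simp add: bij_is_inj inj_eq)
    qed
    show "set_borel_measurable borel (?\<psi> ` ?S) (\<lambda>q. \<bar>\<omega> c' q\<bar>)"
      unfolding image by (rule meas[OF c(2) D(2) S'])
    \<comment> \<open>By \<open>jac\<close> the transformed integrand coincides on \<open>?S\<close>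
      with the continuous density in \<open>c\<close>, so its measurability follows without treating
      the Jacobian separately.\<close>
    have "(\<lambda>p. indicat_real ?S p *\<^sub>R \<bar>\<omega> c p\<bar>) =
        (\<lambda>p. indicat_real ?S p *\<^sub>R (\<bar>det (matrix (?d p))\<bar> * \<bar>\<omega> c' (?\<psi> p)\<bar>))"
      using jac by (auto simp: fun_eq_iff indicator_def)
    with meas[OF c(1) D(3) S]
    show "set_borel_measurable borel ?S (\<lambda>p. \<bar>det (matrix (?d p))\<bar> * \<bar>\<omega> c' (?\<psi> p)\<bar>)"
      unfolding set_borel_measurable_def by simp
  qed simp
  also have "\<dots> = emeasure \<nu> D"
    using nu c(2) D unfolding image by (simp add: volume_measure_def)
  finally show ?thesis .
qed

lemma volume_measure_vimage:
  fixes A :: "('m::{t2_space,second_countable_topology}, 'n::finite) chart set"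
  assumes A: "smooth_manifold A" and om: "volume_form A \<omega>" and nu: "volume_measure A \<omega> \<nu>"
    and phi: "bij \<phi>" "smooth_map A \<phi>" "continuous_on UNIV (inv_into UNIV \<phi>)" "preserves_volume A \<omega> \<phi>"
    and D: "D \<in> sets borel"
  shows "emeasure \<nu> (\<phi> -` D) = emeasure \<nu> D"
proof -
  have sets: "sets \<nu> = sets borel"
    using nu by (simp add: volume_measure_def)
  \<comment> \<open>For bijective \<phi> this is the part of the domain of \<open>c'\<close> that
    \<phi> reaches from the domain of \<open>c\<close>; any subset lies in one chart domain and its
    preimage in the other. Continuity of the inverse makes these sets open.\<close>
  let ?E = "\<lambda>(c, c'). fst c' \<inter> inv_into UNIV \<phi> -` fst c"
  have "open (?E z)" if z: "z \<in> A \<times> A" for z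
  proof -
    have "open (fst c)" if "c \<in> A" for c
      using A that by (auto simp: smooth_manifold_def is_chart_def)
    then show ?thesis
      using z phi(3) by (auto intro!: open_Int open_vimage)
  qed
  then have E_open: "open V" if "V \<in> ?E ` (A \<times> A)" for V
    using that by blast
  then obtain \<E> where E: "\<E> \<subseteq> ?E ` (A \<times> A)" "countable \<E>" "\<Union>\<E> = \<Union>(?E ` (A \<times> A))"
    by (rule Lindelof)
  have cover: "\<Union>(?E ` (A \<times> A)) = UNIV"
    using A by (fastforce simp: smooth_manifold_def)
  \<comment> \<open>A non-empty countable family can be enumerated by all natural numbers, as
    \<open>disjointed\<close> requires.\<close>
  then have "\<E> \<noteq> {}" using E(3) by auto
  then obtain U :: "nat \<Rightarrow> 'm set" where U: "range U = \<E>"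
    using E(2) uncountable_def by blast
  define P where "P n = D \<inter> disjointed U n" for n
  have U_E: "U n \<in> ?E ` (A \<times> A)" for n
    using U E(1) by blast
  then have "U n \<in> sets borel" for n
    by (intro borel_open E_open)
  then have P: "P n \<in> sets borel" for n
    unfolding P_def using D sets.range_disjointed_sets[of U borel] by auto
  have disj: "disjoint_family P"
    using disjoint_family_disjointed[of U] unfolding P_def disjoint_family_on_def by blast
  have UN: "(\<Union>n. P n) = D"
    unfolding P_def using E(3) U cover UN_disjointed_eq[of U] by auto
  have "continuous_on UNIV \<phi>"
    using phi(2) by (simp add: smooth_map_def)
  then have vimage: "\<phi> -` P n \<in> sets borel" for n
    using P measurable_sets[OF borel_measurable_continuous_onI] by fastforce
  have "emeasure \<nu> (\<phi> -` D) = emeasure \<nu> (\<Union>n. \<phi> -` P n)"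
    unfolding UN[symmetric] vimage_UN ..
  also have "\<dots> = (\<Sum>n. emeasure \<nu> (\<phi> -` P n))"
    using disj vimage by (intro suminf_emeasure[symmetric]) (auto simp: sets disjoint_family_on_def)
  also have "\<dots> = (\<Sum>n. emeasure \<nu> (P n))"
  proof (rule suminf_cong)
    fix n
    obtain c c' where cc: "c \<in> A" "c' \<in> A" "U n = fst c' \<inter> inv_into UNIV \<phi> -` fst c"
      using U_E[of n] by auto
    then have "P n \<subseteq> fst c' \<inter> inv_into UNIV \<phi> -` fst c"
      using disjointed_subset[of U n] by (auto simp: P_def)
    then have "P n \<subseteq> fst c'" "\<phi> -` P n \<subseteq> fst c"
      using phi(1) by (auto simp: subset_iff) (metis bij_inv_eq_iff)
    then show "emeasure \<nu> (\<phi> -` P n) = emeasure \<nu> (P n)"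
      by (intro volume_measure_vimage_chart[OF A om nu phi(1,2,4) cc(1,2) P])
  qed
  also have "\<dots> = emeasure \<nu> D"
    using disj P unfolding UN[symmetric] by (intro suminf_emeasure) (auto simp: sets)
  finally show ?thesis .
qed

text \<open>The group laws are assumed here and later supplied by
  \<open>locally_compact_group\<close>. The action is evaluation, so its laws hold by definition of
  composition and identity; the content is invariance of \<open>\<nu>\<close>.\<close>

lemma volume_measure_preserving_action:
  fixes A :: "('m::{t2_space,second_countable_topology}, 'n::finite) chart set"
  assumes A: "smooth_manifold A" and om: "volume_form A \<omega>" and nu: "volume_measure A \<omega> \<nu>"
    and G: "group (isometry_group A g)"
    and inv: "\<forall>\<phi> \<in> carrier (isometry_group A g). preserves_volume A \<omega> \<phi>"
  shows "measure_preserving_action (isometry_group A g) (\<lambda>k x. k x) \<nu>"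
proof -
  interpret group "isometry_group A g" by (rule G)
  have sets: "sets \<nu> = sets borel"
    using nu by (simp add: volume_measure_def)
  show ?thesis
  proof unfold_locales
    fix \<phi> assume phi: "\<phi> \<in> carrier (isometry_group A g)"
    then have iso: "bij \<phi>" "smooth_map A \<phi>" "smooth_map A (inv_into UNIV \<phi>)"
      by (simp_all add: isometry_group_def isometries_def)
    then have "\<phi> \<in> borel_measurable borel"
      by (intro borel_measurable_continuous_onI) (simp add: smooth_map_def)
    then show meas: "\<phi> \<in> \<nu> \<rightarrow>\<^sub>M \<nu>"
      using measurable_cong_sets[OF sets sets] by simp
    show "distr \<nu> \<nu> \<phi> = \<nu>"
    proof (rule measure_eqI)
      fix B assume B: "B \<in> sets (distr \<nu> \<nu> \<phi>)"
      have "emeasure \<nu> (\<phi> -` B) = emeasure \<nu> B"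
        using iso inv phi B
        by (intro volume_measure_vimage[OF A om nu]) (auto simp: smooth_map_def sets)
      then show "emeasure (distr \<nu> \<nu> \<phi>) B = emeasure \<nu> B"
        using meas B sets_eq_imp_space_eq[OF sets] by (simp add: emeasure_distr)
    qed simp
  qed (simp_all add: isometry_group_def)
qed

theorem theorem2:
  fixes A :: "('m::{t2_space,second_countable_topology}, 'n::finite) chart set"
    and g :: "('m, 'n) metric_tensor"
    and G :: "('m \<Rightarrow> 'm) monoid"
    and T :: "('m \<Rightarrow> 'm) topology"
    and \<omega> :: "('m, 'n) form_coeff"
    and \<nu> :: "'m measure"
    and \<mu> :: "('m \<Rightarrow> 'm) measure"
  assumes "riemannian_homogeneous_space A g"
    and "G = isometry_group A g"
    and "T = compact_open_topology (carrier G)"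
    and "locally_compact_group G T"
    and "volume_form A \<omega>"
    and "\<forall>\<phi> \<in> carrier G. preserves_volume A \<omega> \<phi>"
    and "volume_measure A \<omega> \<nu>"
    and "haar_measure G T \<mu>"
  shows
    "(\<forall>w \<in> L2 \<nu>. \<forall>F \<in> L2 \<nu> \<rightarrow> L2 \<mu>.
        (\<forall>f \<in> L2 \<nu>. F f = correlation G (\<lambda>k x. k x) \<nu> f w) \<longrightarrow>
        equivariant G (L2 \<nu>) (pullback_action G (\<lambda>k x. k x) \<nu>)
                      (L2 \<mu>) (pullback_action G (mult G) \<mu>) F \<and>
        (\<forall>\<phi> \<in> carrier G. \<forall>f \<in> L2 \<nu>.
           correlation G (\<lambda>k x. k x) \<nu> (pullback G (\<lambda>k x. k x) \<nu> \<phi> f) w =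
           pullback G (mult G) \<mu> \<phi> (correlation G (\<lambda>k x. k x) \<nu> f w))) \<and>
     (\<forall>w \<in> L2 \<mu>. \<forall>F \<in> L2 \<mu> \<rightarrow> L2 \<mu>.
        (\<forall>f \<in> L2 \<mu>. F f = correlation G (mult G) \<mu> f w) \<longrightarrow>
        equivariant G (L2 \<mu>) (pullback_action G (mult G) \<mu>)
                      (L2 \<mu>) (pullback_action G (mult G) \<mu>) F \<and>
        (\<forall>\<phi> \<in> carrier G. \<forall>f \<in> L2 \<mu>.
           correlation G (mult G) \<mu> (pullback G (mult G) \<mu> \<phi> f) w =
           pullback G (mult G) \<mu> \<phi> (correlation G (mult G) \<mu> f w)))"
proof -
  have haar: "measure_preserving_action G (mult G) \<mu>" "space \<mu> = carrier G"
  proof -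
    show "measure_preserving_action G (mult G) \<mu>"
      using assms(4,8) by (rule haar_measure_preserving_action)
    show "space \<mu> = carrier G"
      using assms(4,8) unfolding locally_compact_group_def haar_measure_def by metis
  qed
  have vol: "measure_preserving_action G (\<lambda>k x. k x) \<nu>"
    using assms volume_measure_preserving_action[of A \<omega> \<nu> g]
    by (simp add: riemannian_homogeneous_space_def locally_compact_group_def)
  \<comment> \<open>Both conjuncts are instances of the same result with target
    \<open>L2 \<mu>\<close>; the acting space is the manifold in the first and \<open>G\<close>
    itself in the second.\<close>
  show ?thesis
    by (intro conjI; intro ballI impI) (rule measure_preserving_action.correlation_equivariant[OF vol haar]
      measure_preserving_action.correlation_equivariant[OF haar(1) haar]; assumption)+
qed

end
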